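(* Let $q=p^m$ with $p$ prime and $m\ge 1$, let $n\ge1$ with $\gcd(n,p)=1$, and let $Q=q^n$. Let $x^n-1=p_1(x)p_2(x)\cdots p_s(x)$ be the decomposition of $x^n-1$ into distinct monic irreducible polynomials in $\mathbb{F}_q[x]$, and let the idempotents $e_i(x)$ $(1\le i\le s)$ of $\mathbb{F}_q[x]/(x^n-1)$ be determined by $$e_i(x)\equiv\delta_{ij}\pmod{p_j(x)}\qquad(1\le j\le s),$$ where $\delta_{ij}=1$ if $i=j$ and $\delta_{ij}=0$ otherwise. Let $E_i(x)=\varphi(e_i(x))$ and $P_i(x)=\varphi(p_i(x))$ $(1\le i\le s)$. For any $\alpha\in\mathbb{F}_Q^\times$, let $$\Delta=\Delta(\alpha)=\{i:1\le i\le s,\ E_i(\alpha)\neq 0\}.$$ Then the minimal $q$-polynomial of $\alpha$ is $M_\Delta(x)=\bigotimes_{i\in\Delta}P_i(x)$, and $\alpha$ is a $k$-normal element for the extension $\mathbb{F}_Q/\mathbb{F}_q$, where $k=n-\sum_{i\in\Delta}\deg p_i(x)$.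
   Context: $\mathbb{F}_Q^\times=\mathbb{F}_Q\setminus\{0\}$. For $0\le k\le n-1$, an element $\alpha\in\mathbb{F}_Q^\times$ is called a $k$-normal element for $\mathbb{F}_Q/\mathbb{F}_q$ if $\gcd(g_\alpha(x),x^n-1)$ has degree $k$, where $g_\alpha(x)=\sum_{i=0}^{n-1}\alpha^{q^i}x^{n-i-1}$. A $q$-polynomial is a polynomial $\sum_{i=0}^m a_i x^{q^i}$ with $a_i\in\mathbb{F}_q$; the set $\mathcal{F}_q[x]$ of all $q$-polynomials is a ring under ordinary addition and the multiplication $L(x)\otimes K(x)=L(K(x))$ (composition). The map $\varphi:\mathbb{F}_q[x]\to\mathcal{F}_q[x]$, $\sum_i a_i x^i\mapsto\sum_i a_i x^{q^i}$, is a ring isomorphism, so $\mathcal{F}_q[x]$ is a principal ideal domain with identity $x$ (and $\bigotimes$ denotes a product in this commutative ring). For $\alpha\in\mathbb{F}_Q^\times$, the set $I_\alpha=\{M(x)\in\mathcal{F}_q[x]: M(\alpha)=0\}$ is a nonzero ideal of $\mathcal{F}_q[x]$, and its monic generator is called the minimal $q$-polynomial of $\alpha$. The element $e_i(x)$ is a class modulo $x^n-1$; when applying $\varphi$ one uses a polynomial representative, e.g. the one of degree less than $n$ (the value $E_i(\alpha)$ for $\alpha\in\mathbb{F}_Q$ does not depend on the representative). *)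

theory Defs
  imports
    "HOL-Algebra.Ideal"
    "HOL-Computational_Algebra.Polynomial"
    "HOL-Computational_Algebra.Primes"
    "HOL-Number_Theory.Cong"
    "HOL-Library.Cardinality"
begin

text \<open>
  Throughout, the ground field with \<open>q\<close> elements is a type \<open>'k\<close>, its extension of degree \<open>n\<close> is a
  type \<open>'a\<close>, and the inclusion is a unital ring homomorphism \<open>\<iota> :: 'k \<Rightarrow> 'a\<close>. The \<open>q\<close>-polynomials
  have their coefficients in the ground field and are evaluated in the extension through \<open>\<iota>\<close>.
\<close>

definition qpolys :: "nat \<Rightarrow> 'k::field poly set" where
  "qpolys q = {L. \<exists>(m::nat) (a :: nat \<Rightarrow> 'k). L = (\<Sum>i\<le>m. monom (a i) (q ^ i))}"

definition qpoly_ring :: "nat \<Rightarrow> 'k::field poly ring" where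
  "qpoly_ring q =
     \<lparr>carrier = qpolys q,
      monoid.mult = (\<lambda>L K. L \<circ>\<^sub>p K),
      one = monom 1 1,
      zero = 0,
      add = (+)\<rparr>"

definition qassoc :: "nat \<Rightarrow> 'k::field poly \<Rightarrow> 'k poly" where
  "qassoc q f = (\<Sum>i\<le>degree f. monom (coeff f i) (q ^ i))"

definition eval_ext :: "('k::field \<Rightarrow> 'a::field) \<Rightarrow> 'k poly \<Rightarrow> 'a \<Rightarrow> 'a" where
  "eval_ext \<iota> L \<alpha> = poly (map_poly \<iota> L) \<alpha>"

definition qannihilator :: "('k::field \<Rightarrow> 'a::field) \<Rightarrow> nat \<Rightarrow> 'a \<Rightarrow> 'k poly set" where
  "qannihilator \<iota> q \<alpha> = {M \<in> carrier (qpoly_ring q). eval_ext \<iota> M \<alpha> = 0}"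

definition min_qpoly :: "('k::field \<Rightarrow> 'a::field) \<Rightarrow> nat \<Rightarrow> 'a \<Rightarrow> 'k poly" where
  "min_qpoly \<iota> q \<alpha> =
     (THE M. M \<in> carrier (qpoly_ring q) \<and> lead_coeff M = 1 \<and>
             qannihilator \<iota> q \<alpha> = PIdl\<^bsub>qpoly_ring q\<^esub> M)"

text \<open>
  The overloaded \<open>gcd\<close> on polynomials needs coefficients of class \<open>field_gcd\<close>. The divisibility
  formulation below applies to every field, and agrees with \<open>gcd\<close> up to a unit where both exist.
\<close>

definition is_gcd :: "'b::comm_semiring_1 \<Rightarrow> 'b \<Rightarrow> 'b \<Rightarrow> bool" where
  "is_gcd d a b \<longleftrightarrow> d dvd a \<and> d dvd b \<and> (\<forall>c. c dvd a \<and> c dvd b \<longrightarrow> c dvd d)"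

lemma is_gcd_gcd: "is_gcd (gcd a b) a (b :: 'b::semiring_gcd)"
  by (simp add: is_gcd_def)

lemma is_gcd_degree_unique:
  fixes a b :: "'b::field poly"
  assumes "is_gcd d a b" "is_gcd d' a b"
  shows "degree d = degree d'"
proof -
  have "d dvd d'" "d' dvd d" using assms by (auto simp: is_gcd_def)
  then show ?thesis
    by (metis dvd_imp_degree_le dvd_0_left_iff order_antisym)
qed

definition normal_poly :: "nat \<Rightarrow> nat \<Rightarrow> 'a::field \<Rightarrow> 'a poly" where
  "normal_poly q n \<alpha> = (\<Sum>i<n. monom (\<alpha> ^ (q ^ i)) (n - i - 1))"

definition k_normal :: "nat \<Rightarrow> nat \<Rightarrow> nat \<Rightarrow> 'a::field \<Rightarrow> bool" where
  "k_normal q n k \<alpha> \<longleftrightarrow>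
     \<alpha> \<noteq> 0 \<and> k < n \<and>
     (\<exists>d. is_gcd d (normal_poly q n \<alpha>) (monom 1 n - 1) \<and> degree d = k)"

end

(*
  F_q[x] acts on F_Q by letting x act as the Frobenius map, so that f sends \<alpha> to phi(f)(\<alpha>), and
  x^n - 1 acts as zero. The idempotents e_i split \<alpha> into the components E_i(\<alpha>), each
  annihilated by p_i; an irreducible polynomial generates the annihilator of any nonzero element
  it kills. So the annihilator of \<alpha> is generated by the product M of the p_i with i in \<Delta>.

  For normality, multiplying g_\<alpha> by f in F_q[x] gives the polynomial g of phi(f)(\<alpha>) modulo
  x^n - 1, so f g_\<alpha> is divisible by x^n - 1 iff M divides f. By Galois descent the same
  criterion holds for f over F_Q, hence gcd(g_\<alpha>, x^n - 1) = (x^n - 1) / M.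
*)
theory Submission
  imports Defs "HOL-Computational_Algebra.Polynomial_Factorial"
begin

section \<open>Ideals and coprime factors in a polynomial ring over a field\<close>

lemma poly_ideal_generator:
  fixes I :: "'b::field poly set"
  assumes "P \<in> I" "P \<noteq> 0"
    and diff: "\<And>f g. f \<in> I \<Longrightarrow> g \<in> I \<Longrightarrow> f - g \<in> I"
    and mult: "\<And>f g. f \<in> I \<Longrightarrow> g * f \<in> I"
  obtains D where "D \<in> I" "lead_coeff D = 1" "\<And>f. f \<in> I \<Longrightarrow> D dvd f"
proof -
  \<comment> \<open>A nonzero member of least degree divides every other one, as the remainder is
    again a member and has smaller degree unless it vanishes.\<close>
  obtain C where C: "C \<in> I" "C \<noteq> 0" and min: "\<And>f. f \<in> I \<Longrightarrow> f \<noteq> 0 \<Longrightarrow> degree C \<le> degree f"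
    using ex_has_least_nat[of "\<lambda>f. f \<in> I \<and> f \<noteq> 0" P degree] assms(1,2) by blast
  define D where "D = smult (inverse (lead_coeff C)) C"
  have "D \<in> I"
    using mult[OF C(1), of "[:inverse (lead_coeff C):]"] by (simp add: D_def)
  moreover have "lead_coeff D = 1"
    using C(2) by (simp add: D_def)
  moreover have "D dvd f" if "f \<in> I" for f
  proof -
    have "f mod C = f - f div C * C"
      by (simp add: minus_div_mult_eq_mod)
    then have "f mod C \<in> I"
      using diff[OF that mult[OF C(1)]] by simp
    then have "f mod C = 0"
      using min[of "f mod C"] degree_mod_less[of C f] C(2) by fastforce
    then have "C dvd f"
      by (rule mod_0_imp_dvd)
    then show ?thesis
      using C(2) by (simp add: D_def smult_dvd_iff)
  qed
  ultimately show thesis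
    using that by blast
qed

lemma monic_dvd_antisym:
  fixes f g :: "'b::field poly"
  assumes "f dvd g" "g dvd f" "lead_coeff f = 1" "lead_coeff g = 1"
  shows "f = g"
proof -
  obtain h where h: "g = f * h" using assms(1) by blast
  have "g \<noteq> 0" "f \<noteq> 0" using assms by auto
  then have "degree f = degree g"
    using assms by (intro antisym dvd_imp_degree_le)
  moreover have "degree g = degree f + degree h"
    using h \<open>g \<noteq> 0\<close> degree_mult_eq by fastforce
  ultimately have "degree h = 0" by simp
  then obtain c where "h = [:c:]" by (rule degree_eq_zeroE)
  with h have g: "g = smult c f" by simp
  then have "c = 1" using assms(3,4) by (metis lead_coeff_smult mult.right_neutral)
  with g show ?thesis by simp
qed

lemma prime_elem_dvd_prodE:
  assumes "finite S" "prime_elem p" "p dvd prod f S"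
  obtains i where "i \<in> S" "p dvd f i"
proof -
  have "\<exists>i\<in>S. p dvd f i"
    using assms(1,3)
    by (induction S rule: finite_induct)
       (use assms(2) in \<open>auto simp: prime_elem_dvd_mult_iff prime_elem_not_unit\<close>)
  then show thesis using that by blast
qed

text \<open>Distinct monic irreducibles are non-associated primes. A new factor therefore does not
  divide the product of the earlier ones and must divide the cofactor.\<close>

lemma prod_monic_irreducible_dvd:
  fixes f :: "'i \<Rightarrow> 'b::field poly"
  assumes "finite S" "inj_on f S"
    and "\<And>i. i \<in> S \<Longrightarrow> irreducible (f i)" "\<And>i. i \<in> S \<Longrightarrow> lead_coeff (f i) = 1"
    and "\<And>i. i \<in> S \<Longrightarrow> f i dvd g"
  shows "(\<Prod>i\<in>S. f i) dvd g"
  using assms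
proof (induction S rule: finite_induct)
  case (insert i S)
  have "prod f S dvd g" using insert by (intro insert.IH) auto
  then obtain c where c: "g = prod f S * c" by blast
  have pr: "prime_elem (f i)"
    using insert by (intro field_poly_irreducible_imp_prime) auto
  have "\<not> f i dvd f j" if "j \<in> S" for j
  proof
    assume d: "f i dvd f j"
    moreover have "\<not> is_unit (f i)" and "irreducible (f j)"
      using insert that irreducible_not_unit by auto
    ultimately have "f j dvd f i" using irreducibleD' by blast
    with d have "f i = f j" using insert that by (intro monic_dvd_antisym) auto
    then show False using insert that by (auto simp: inj_on_def)
  qed
  then have "\<not> f i dvd prod f S"
    using prime_elem_dvd_prodE[OF \<open>finite S\<close> pr] by metis
  moreover have "f i dvd prod f S * c" using insert c by auto
  ultimately have "f i dvd c" using pr by (simp add: prime_elem_dvd_mult_iff)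
  then show ?case
    using insert c by (simp add: mult.commute mult_dvd_mono)
qed simp

section \<open>Coefficientwise maps and finite fields\<close>

lemma map_poly_add_hom:
  assumes "f 0 = 0" "\<And>x y. f (x + y) = f x + f y"
  shows "map_poly f (P + Q) = map_poly f P + map_poly f Q"
  by (intro poly_eqI) (simp add: coeff_map_poly assms)

lemma map_poly_mult_hom:
  fixes f :: "'b::comm_semiring_0 \<Rightarrow> 'c::comm_semiring_0"
  assumes "f 0 = 0" "\<And>x y. f (x + y) = f x + f y" "\<And>x y. f (x * y) = f x * f y"
  shows "map_poly f (P * Q) = map_poly f P * map_poly f Q"
  by (induction P)
     (simp_all add: map_poly_add_hom map_poly_smult map_poly_pCons assms)

text \<open>Multiplication by a nonzero \<open>x\<close> permutes the nonzero elements; comparing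
  their products before and after gives Fermat's identity.\<close>

lemma power_card_field:
  fixes x :: "'b::{finite,field}"
  shows "x ^ CARD('b) = x"
proof (cases "x = 0")
  case False
  have "x ^ card (UNIV - {0::'b}) * (\<Prod>y\<in>UNIV-{0}. y) = (\<Prod>y\<in>UNIV-{0}. x * y)"
    by (simp add: prod.distrib)
  also have "\<dots> = (\<Prod>y\<in>UNIV-{0}. y)"
    by (rule prod.reindex_bij_witness[of _ "\<lambda>y. y / x" "\<lambda>y. x * y"]) (use False in auto)
  finally have "x ^ card (UNIV - {0::'b}) = 1"
    by (simp add: prod_zero_iff)
  moreover have "CARD('b) = Suc (card (UNIV - {0::'b}))"
    by (rule card.remove) auto
  ultimately show ?thesis by (simp only: power_Suc mult_1_right)
qed (simp add: power_0_left)

text \<open>The shift by 1 permutes the field, so comparing sums shows that its cardinality vanishes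
  in it. The characteristic is then a prime dividing a power of \<open>p\<close>.\<close>

lemma CHAR_eq_of_card_prime_power:
  assumes "prime p" "CARD('b::{finite,field}) = p ^ k"
  shows "CHAR('b) = p"
proof -
  have "(\<Sum>y\<in>UNIV. y + 1) = (\<Sum>y\<in>UNIV. (y::'b))"
    by (rule sum.reindex_bij_witness[of _ "\<lambda>y. y - 1" "\<lambda>y. y + 1"]) auto
  then have "of_nat (CARD('b)) = (0::'b)"
    by (simp add: sum.distrib)
  then have "CHAR('b) dvd p ^ k"
    unfolding of_nat_eq_0_iff_char_dvd assms(2) .
  moreover have "prime CHAR('b)"
    by (intro prime_CHAR_semidom finite_imp_CHAR_pos) auto
  ultimately show ?thesis
    using assms(1) by (meson prime_dvd_power_nat primes_dvd_imp_eq)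
qed

section \<open>The passage from polynomials to q-polynomials\<close>

lemma pcompose_monom_left: "monom c n \<circ>\<^sub>p g = smult c (g ^ n)"
  by (induction n) (simp_all add: monom_0 monom_Suc pcompose_pCons)

lemma qassoc_eq_sum:
  assumes "degree f \<le> N"
  shows "qassoc q f = (\<Sum>i\<le>N. monom (coeff f i) (q ^ i))"
  unfolding qassoc_def using assms
  by (intro sum.mono_neutral_left) (auto simp: coeff_eq_0)

lemma qassoc_0 [simp]: "qassoc q 0 = 0"
  by (simp add: qassoc_def)

lemma qassoc_1: "qassoc q 1 = monom 1 1"
  by (simp add: qassoc_def)

lemma qassoc_add: "qassoc q (f + g) = qassoc q f + qassoc q g"
proof -
  define N where "N = max (degree f) (degree g)"
  have "degree f \<le> N" "degree g \<le> N" "degree (f + g) \<le> N"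
    by (auto simp: N_def degree_add_le_max)
  then show ?thesis
    by (simp add: qassoc_eq_sum[of _ N] sum.distrib flip: add_monom)
qed

lemma qassoc_smult: "qassoc q (smult c f) = smult c (qassoc q f)"
proof -
  have "degree (smult c f) \<le> degree f" by (rule degree_smult_le)
  then show ?thesis
    by (intro poly_eqI)
       (auto simp: qassoc_eq_sum[of _ "degree f"] coeff_sum sum_distrib_left intro!: sum.cong)
qed

text \<open>A factor x turns into a substitution of x^q. This recursion drives the later inductions
  over \<open>pCons\<close>.\<close>

lemma qassoc_pCons: "qassoc q (pCons c f) = monom c 1 + qassoc q f \<circ>\<^sub>p monom 1 q"
proof -
  have "degree (pCons c f) \<le> Suc (degree f)"
    by (simp add: degree_pCons_le)
  then have "qassoc q (pCons c f) = (\<Sum>i\<le>Suc (degree f). monom (coeff (pCons c f) i) (q ^ i))"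
    by (rule qassoc_eq_sum)
  also have "\<dots> = monom c 1 + (\<Sum>i\<le>degree f. monom (coeff f i) (q * q ^ i))"
    by (subst sum.atMost_Suc_shift) simp
  also have "(\<Sum>i\<le>degree f. monom (coeff f i) (q * q ^ i)) = qassoc q f \<circ>\<^sub>p monom 1 q"
    unfolding qassoc_def
    by (simp add: pcompose_sum monom_power pcompose_monom_left smult_monom mult.commute)
  finally show ?thesis .
qed

text \<open>For \<open>q > 1\<close> the exponents \<open>q ^ i\<close> are pairwise distinct, so no
  two terms merge. Beyond the degree of \<open>f\<close> both sides are 0.\<close>

lemma coeff_qassoc:
  assumes "q > 1"
  shows "coeff (qassoc q f) (q ^ i) = coeff f i"
proof -
  have "coeff (qassoc q f) (q ^ i) = (\<Sum>j\<le>degree f. if j = i then coeff f j else 0)"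
    unfolding qassoc_def coeff_sum coeff_monom
    using assms by (intro sum.cong) (auto simp: power_inject_exp)
  also have "\<dots> = coeff f i"
    by (simp add: coeff_eq_0)
  finally show ?thesis .
qed

lemma inj_qassoc: "q > 1 \<Longrightarrow> inj (qassoc q)"
  by (intro injI poly_eqI) (metis coeff_qassoc)

lemma lead_coeff_qassoc:
  assumes "q > 1"
  shows "lead_coeff (qassoc q f) = lead_coeff f"
proof (cases "f = 0")
  case False
  have "degree (qassoc q f) \<le> q ^ degree f"
    unfolding qassoc_def using assms
    by (intro degree_sum_le) (auto intro: order_trans[OF degree_monom_le] power_increasing)
  moreover have "q ^ degree f \<le> degree (qassoc q f)"
    using False assms by (intro le_degree) (simp add: coeff_qassoc)
  ultimately have "degree (qassoc q f) = q ^ degree f" by simp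
  then show ?thesis
    using coeff_qassoc[OF assms] by metis
qed simp

lemma qpolys_eq_range:
  assumes "q > 1"
  shows "qpolys q = range (qassoc q)"
proof (intro equalityI subsetI)
  fix L :: "'a poly"
  assume "L \<in> qpolys q"
  then obtain m a where L: "L = (\<Sum>i\<le>m. monom (a i) (q ^ i))"
    by (auto simp: qpolys_def)
  define f where "f = (\<Sum>i\<le>m. monom (a i) i)"
  have "coeff f i = a i" if "i \<le> m" for i
    using that by (simp add: f_def coeff_sum)
  moreover have "degree f \<le> m"
    unfolding f_def by (intro degree_sum_le) (auto intro: order_trans[OF degree_monom_le])
  ultimately have "L = qassoc q f"
    by (simp add: L qassoc_eq_sum)
  then show "L \<in> range (qassoc q)" by blast
qed (auto simp: qpolys_def qassoc_def)

section \<open>The field extension and its Frobenius map\<close>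

locale finite_field_extension =
  fixes \<iota> :: "'k::{finite, field} \<Rightarrow> 'a::{finite, field}"
    and p m q n :: nat
  assumes prime_p: "prime p" and m_pos: "m \<ge> 1" and q_eq: "q = p ^ m" and n_pos: "n \<ge> 1"
    and card_k: "CARD('k) = q" and card_a: "CARD('a) = q ^ n"
    and hom_1 [simp]: "\<iota> 1 = 1"
    and hom_add: "\<And>x y. \<iota> (x + y) = \<iota> x + \<iota> y"
    and hom_mult: "\<And>x y. \<iota> (x * y) = \<iota> x * \<iota> y"
begin

lemma q_gt_1: "q > 1"
  using one_less_power[of p m] prime_gt_1_nat[OF prime_p] m_pos by (simp add: q_eq)

lemma hom_0 [simp]: "\<iota> 0 = 0"
  using hom_add[of 0 0] by (metis add_0 add_cancel_right_right)

lemma hom_eq_0_iff [simp]: "\<iota> x = 0 \<longleftrightarrow> x = 0"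
proof
  assume "\<iota> x = 0"
  then have "\<iota> (x * inverse x) = 0" by (simp add: hom_mult)
  then show "x = 0" by (cases "x = 0") auto
qed simp

lemma hom_diff: "\<iota> (x - y) = \<iota> x - \<iota> y"
  using hom_add[of "x - y" y] by (simp only: diff_add_cancel eq_diff_eq)

lemma inj_hom: "inj \<iota>"
  by (rule injI) (metis hom_diff hom_eq_0_iff right_minus_eq)

lemma hom_power: "\<iota> (x ^ k) = \<iota> x ^ k"
  by (induction k) (simp_all add: hom_mult)

lemma char_k: "CHAR('k) = p"
  by (rule CHAR_eq_of_card_prime_power[OF prime_p, where k = m]) (simp add: card_k q_eq)

lemma char_a: "CHAR('a) = p"
  by (rule CHAR_eq_of_card_prime_power[OF prime_p, where k = "m * n"])
     (simp add: card_a q_eq power_mult)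

lemma power_q_add: "(x + y :: 'a) ^ q = x ^ q + y ^ q"
  by (rule freshmans_dream') (simp_all add: char_a prime_p q_eq)

lemma poly_power_q_add: "(f + g :: 'k poly) ^ q = f ^ q + g ^ q"
  by (rule freshmans_dream') (simp_all add: char_k prime_p q_eq)

lemma power_qi_add: "(x + y :: 'a) ^ (q ^ i) = x ^ (q ^ i) + y ^ (q ^ i)"
  by (induction i arbitrary: x y) (simp_all add: power_mult power_q_add)

lemma power_q: "(c :: 'k) ^ q = c"
  using power_card_field[of c] by (simp add: card_k)

lemma hom_power_qi: "\<iota> c ^ (q ^ i) = \<iota> c"
  by (induction i) (simp_all add: power_mult power_q flip: hom_power)

lemma power_qn: "(x :: 'a) ^ (q ^ n) = x"
  using power_card_field[of x] by (simp add: card_a)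

text \<open>The image of \<iota> already supplies q roots of x^q - x, and there can be no more. This
  is the Galois descent for single elements.\<close>

lemma power_q_eq_self:
  assumes "x ^ q = x"
  shows "x \<in> range \<iota>"
proof -
  define P :: "'a poly" where "P = monom 1 q - monom 1 1"
  have "coeff P q = 1" using q_gt_1 by (simp add: P_def)
  then have "P \<noteq> 0" by auto
  have "degree P \<le> q"
    unfolding P_def using q_gt_1 by (intro degree_diff_le order_trans[OF degree_monom_le]) auto
  have "card {y. poly P y = 0} \<le> card (range \<iota>)"
    using card_poly_roots_bound[OF \<open>P \<noteq> 0\<close>] \<open>degree P \<le> q\<close> inj_hom
    by (simp add: card_image card_k)
  moreover have "range \<iota> \<subseteq> {y. poly P y = 0}"
    using hom_power_qi[of _ 1] by (auto simp: P_def poly_monom)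
  ultimately have "range \<iota> = {y. poly P y = 0}"
    by (intro card_seteq) auto
  with assms show ?thesis by (simp add: P_def poly_monom)
qed

text \<open>The q-th power is additive and fixes coefficients in the ground field, so only the
  variable changes.\<close>

lemma poly_power_q: "(f :: 'k poly) ^ q = f \<circ>\<^sub>p monom 1 q"
proof (induction f)
  case 0
  then show ?case using q_gt_1 by simp
next
  case (pCons c f)
  have "pCons c f ^ q = ([:c:] + monom 1 1 * f) ^ q"
    by (simp add: monom_altdef)
  also have "\<dots> = [:c:] + monom 1 q * f ^ q"
    by (simp add: poly_power_q_add power_mult_distrib monom_power poly_const_pow power_q)
  finally show ?case
    by (simp add: pCons.IH pcompose_pCons)
qed

lemma qassoc_mult: "qassoc q (f * g :: 'k poly) = qassoc q f \<circ>\<^sub>p qassoc q g"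
proof (induction f)
  case (pCons c f)
  have "qassoc q (pCons c f * g) = smult c (qassoc q g) + qassoc q f \<circ>\<^sub>p qassoc q g \<circ>\<^sub>p monom 1 q"
    by (simp add: qassoc_add qassoc_smult qassoc_pCons pCons.IH)
  \<comment> \<open>Substituting x^q into a q-polynomial over the ground field equals taking its
    q-th power. So x^q moves from the inside of the composition to the outside, where it becomes
    part of the left factor.\<close>
  also have "\<dots> = smult c (qassoc q g) + qassoc q f \<circ>\<^sub>p (qassoc q g ^ q)"
    by (simp add: poly_power_q pcompose_assoc)
  also have "\<dots> = qassoc q (pCons c f) \<circ>\<^sub>p qassoc q g"
    by (simp add: qassoc_pCons pcompose_add pcompose_monom_left flip: pcompose_assoc)
  finally show ?case .
qed simp

section \<open>Products and principal ideals of q-polynomials\<close>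

lemma carrier_qpoly_ring: "carrier (qpoly_ring q) = range (qassoc q :: 'k poly \<Rightarrow> _)"
  by (simp add: qpoly_ring_def qpolys_eq_range[OF q_gt_1])

lemma qpoly_ring_mult: "qassoc q f \<otimes>\<^bsub>qpoly_ring q\<^esub> qassoc q g = qassoc q (f * g :: 'k poly)"
  by (simp add: qpoly_ring_def qassoc_mult)

lemma qpoly_ring_one: "\<one>\<^bsub>qpoly_ring q\<^esub> = (qassoc q 1 :: 'k poly)"
  by (simp add: qpoly_ring_def qassoc_1)

text \<open>Commutativity of composition is inherited from multiplication of polynomials; it gives
  the finite products over \<Delta> their meaning.\<close>

lemma comm_monoid_qpoly_ring: "comm_monoid (qpoly_ring q :: 'k poly ring)"
  by (rule comm_monoidI)
     (auto simp: carrier_qpoly_ring qpoly_ring_mult qpoly_ring_one mult_ac)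

lemma finprod_qassoc:
  fixes f :: "'i \<Rightarrow> 'k poly"
  assumes "finite S"
  shows "(\<Otimes>\<^bsub>qpoly_ring q\<^esub>i\<in>S. qassoc q (f i)) = qassoc q (\<Prod>i\<in>S. f i)"
proof -
  interpret comm_monoid "qpoly_ring q :: 'k poly ring" by (rule comm_monoid_qpoly_ring)
  show ?thesis
    using assms
    by (induction S rule: finite_induct)
       (simp_all add: qpoly_ring_one carrier_qpoly_ring qpoly_ring_mult)
qed

lemma cgenideal_qassoc: "PIdl\<^bsub>qpoly_ring q\<^esub> (qassoc q f) = qassoc q ` {g :: 'k poly. f dvd g}"
  unfolding cgenideal_def carrier_qpoly_ring
  by (auto simp: qpoly_ring_mult dvd_def image_iff) (metis qpoly_ring_mult mult.commute)+

section \<open>The extension field as a module over the polynomials\<close>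

lemma map_poly_hom_add: "map_poly \<iota> (f + g) = map_poly \<iota> f + map_poly \<iota> g"
  by (simp add: map_poly_add_hom hom_add)

lemma map_poly_hom_mult: "map_poly \<iota> (f * g) = map_poly \<iota> f * map_poly \<iota> g"
  by (simp add: map_poly_mult_hom hom_add hom_mult)

lemma map_poly_hom_diff: "map_poly \<iota> (f - g) = map_poly \<iota> f - map_poly \<iota> g"
  by (intro poly_eqI) (simp add: coeff_map_poly hom_diff)

text \<open>Scalar multiplication of the module in which x acts as the Frobenius map;
  \<open>act_add\<close> and \<open>act_mult\<close> give the module laws.\<close>

definition act :: "'k poly \<Rightarrow> 'a \<Rightarrow> 'a" where
  "act f \<alpha> = eval_ext \<iota> (qassoc q f) \<alpha>"

lemma act_0 [simp]: "act 0 \<alpha> = 0"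
  by (simp add: act_def eval_ext_def)

lemma act_1 [simp]: "act 1 \<alpha> = \<alpha>"
  by (simp add: act_def eval_ext_def qassoc_1 map_poly_monom poly_monom)

lemma act_add: "act (f + g) \<alpha> = act f \<alpha> + act g \<alpha>"
  by (simp add: act_def eval_ext_def qassoc_add map_poly_hom_add)

lemma act_diff: "act (f - g) \<alpha> = act f \<alpha> - act g \<alpha>"
  using act_add[of "f - g" g] by simp

lemma act_sum: "act (\<Sum>i\<in>S. f i) \<alpha> = (\<Sum>i\<in>S. act (f i) \<alpha>)"
  by (induction S rule: infinite_finite_induct) (simp_all add: act_add)

lemma map_poly_hom_pcompose: "map_poly \<iota> (f \<circ>\<^sub>p g) = map_poly \<iota> f \<circ>\<^sub>p map_poly \<iota> g"
  by (induction f) (simp_all add: pcompose_pCons map_poly_hom_add map_poly_hom_mult map_poly_pCons)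

lemma act_mult: "act (f * g) \<alpha> = act f (act g \<alpha>)"
  by (simp add: act_def eval_ext_def qassoc_mult map_poly_hom_pcompose poly_pcompose)

lemma act_pCons: "act (pCons c f) \<alpha> = \<iota> c * \<alpha> + act f (\<alpha> ^ q)"
  by (simp add: act_def eval_ext_def qassoc_pCons map_poly_hom_add map_poly_hom_pcompose
      map_poly_monom poly_pcompose poly_monom)

lemma act_zero_right [simp]: "act f 0 = 0"
  using act_mult[of f 0 0] by simp

lemma act_monom: "act (monom 1 k) \<alpha> = \<alpha> ^ (q ^ k)"
  by (induction k arbitrary: \<alpha>) (simp_all add: monom_Suc act_pCons power_mult)

lemma act_x_power_n: "act (monom 1 n - 1) \<alpha> = 0"
  by (simp add: act_diff act_monom power_qn)

lemma act_eq_0_dvd: "act f \<alpha> = 0 \<Longrightarrow> f dvd g \<Longrightarrow> act g \<alpha> = 0"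
  by (metis dvd_def act_mult act_zero_right mult.commute)

text \<open>The generator \<open>D\<close> of the annihilator of \<beta> divides \<open>P\<close>.
  It is no unit because 1 does not kill \<beta>, so it is associated to \<open>P\<close>.\<close>

lemma irreducible_dvd_annihilator:
  assumes "irreducible P" "act P \<beta> = 0" "act f \<beta> = 0" "\<beta> \<noteq> 0"
  shows "P dvd f"
proof -
  have "P \<noteq> 0" using assms(1) by auto
  obtain D where D: "act D \<beta> = 0" "\<And>g. act g \<beta> = 0 \<Longrightarrow> D dvd g"
    by (rule poly_ideal_generator[of P "{g. act g \<beta> = 0}"])
       (use assms(2) \<open>P \<noteq> 0\<close> in \<open>auto simp: act_diff act_mult\<close>)
  have "\<not> D dvd 1" using act_eq_0_dvd[OF D(1), of 1] assms(4) by auto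
  then have "P dvd D" using assms(1) D(2)[OF assms(2)] irreducibleD' by blast
  with D(2)[OF assms(3)] show ?thesis by (rule dvd_trans[rotated])
qed

section \<open>The polynomials g_\<alpha> modulo x^n - 1\<close>

lemma normal_poly_add: "normal_poly q n (x + y) = normal_poly q n x + normal_poly q n (y :: 'a)"
  by (simp add: normal_poly_def power_qi_add sum.distrib flip: add_monom)

lemma normal_poly_smult: "normal_poly q n (\<iota> c * x) = smult (\<iota> c) (normal_poly q n x)"
  by (intro poly_eqI)
     (auto simp: normal_poly_def power_mult_distrib hom_power_qi coeff_sum sum_distrib_left
       intro!: sum.cong)

lemma normal_poly_0 [simp]: "normal_poly q n (0 :: 'a) = 0"
  using normal_poly_add[of 0 0] by (metis add_0 add_cancel_right_right)

lemma map_poly_frobenius_normal_poly: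
  "map_poly (\<lambda>x. x ^ q) (normal_poly q n \<alpha>) = normal_poly q n (\<alpha> ^ q :: 'a)"
proof (rule poly_eqI)
  fix j
  have "(\<Sum>i\<in>S. h i :: 'a) ^ q = (\<Sum>i\<in>S. h i ^ q)" for S and h :: "nat \<Rightarrow> 'a"
    by (rule freshmans_dream_sum') (simp_all add: char_a prime_p q_eq)
  then show "coeff (map_poly (\<lambda>x. x ^ q) (normal_poly q n \<alpha>)) j = coeff (normal_poly q n (\<alpha> ^ q)) j"
    using q_gt_1 unfolding normal_poly_def
    by (subst coeff_map_poly)
       (auto simp: coeff_sum power_0_left mult.commute simp flip: power_mult intro!: sum.cong)
qed

text \<open>Both products run over the same terms \<open>h i\<close> up to an index shift, so only
  the end terms differ. The last one is the constant \<alpha>, since \<alpha> is fixed by the n-th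
  power of Frobenius.\<close>

lemma normal_poly_shift:
  "monom 1 1 * normal_poly q n \<alpha> = normal_poly q n (\<alpha> ^ q :: 'a) + smult \<alpha> (monom 1 n - 1)"
proof -
  define h where "h i = monom (\<alpha> ^ (q ^ i)) (n - i)" for i
  have "monom 1 1 * normal_poly q n \<alpha> = (\<Sum>i<n. h i)"
    unfolding normal_poly_def h_def
    by (simp add: sum_distrib_left mult_monom Suc_diff_Suc)
  moreover have "normal_poly q n (\<alpha> ^ q) = (\<Sum>i<n. h (Suc i))"
    unfolding normal_poly_def h_def by (simp flip: power_mult)
  moreover have "(\<Sum>i<n. h (Suc i)) = (\<Sum>i<n. h i) + h n - h 0"
    using sum.lessThan_Suc_shift[of h n] by simp
  moreover have "smult \<alpha> (monom 1 n - 1) = h 0 - h n"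
    by (simp add: h_def power_qn smult_diff_right smult_monom monom_0)
  ultimately show ?thesis by simp
qed

text \<open>Modulo x^n - 1 the map from \<alpha> to g_\<alpha> is linear over the polynomials with
  ground field coefficients: constants pass through directly, and x by
  \<open>normal_poly_shift\<close>. The induction hypothesis is needed at
  \<open>\<alpha> ^ q\<close>.\<close>

lemma normal_poly_act:
  "(monom 1 n - 1) dvd map_poly \<iota> f * normal_poly q n \<alpha> - normal_poly q n (act f \<alpha>)"
proof (induction f arbitrary: \<alpha>)
  case (pCons c f)
  have "map_poly \<iota> (pCons c f) * normal_poly q n \<alpha> - normal_poly q n (act (pCons c f) \<alpha>)
      = map_poly \<iota> f * (monom 1 1 * normal_poly q n \<alpha>) - normal_poly q n (act f (\<alpha> ^ q))"
    by (simp add: map_poly_pCons act_pCons normal_poly_add normal_poly_smult monom_altdef)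
  also have "\<dots> = (map_poly \<iota> f * normal_poly q n (\<alpha> ^ q) - normal_poly q n (act f (\<alpha> ^ q)))
      + smult \<alpha> (map_poly \<iota> f) * (monom 1 n - 1)"
    by (simp only: normal_poly_shift) (simp add: algebra_simps)
  finally show ?case
    using pCons.IH by (metis dvd_add dvd_triv_right)
qed simp

lemma degree_x_power_n: "degree (monom 1 n - 1 :: 'b::field poly) = n"
proof -
  have "degree (monom 1 n + (- 1) :: 'b poly) = degree (monom 1 n :: 'b poly)"
    using n_pos by (intro degree_add_eq_left) (simp add: degree_monom_eq)
  then show ?thesis by (simp add: degree_monom_eq)
qed

lemma x_power_n_nonzero: "monom 1 n - 1 \<noteq> (0 :: 'b::field poly)"
  using degree_x_power_n n_pos by (metis degree_0 not_one_le_zero)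

text \<open>A polynomial of degree below n that is divisible by x^n - 1 is zero, and \<beta> is the
  coefficient of x^(n-1). So nothing is lost modulo x^n - 1.\<close>

lemma normal_poly_dvd_0:
  assumes "(monom 1 n - 1) dvd normal_poly q n \<beta>"
  shows "\<beta> = (0 :: 'a)"
proof -
  have "degree (normal_poly q n \<beta>) \<le> n - 1"
    unfolding normal_poly_def
    by (intro degree_sum_le) (auto intro: order_trans[OF degree_monom_le])
  then have "degree (normal_poly q n \<beta>) < degree (monom 1 n - 1 :: 'a poly)"
    using n_pos by (simp add: degree_x_power_n)
  then have "normal_poly q n \<beta> = 0"
    using assms dvd_imp_degree_le leD by blast
  then have "coeff (normal_poly q n \<beta>) (n - 1) = 0"
    by simp
  moreover have "coeff (normal_poly q n \<beta>) (n - 1) = (\<Sum>i<n. if i = 0 then \<beta> else 0)"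
    unfolding normal_poly_def coeff_sum coeff_monom using n_pos by (intro sum.cong) auto
  ultimately show ?thesis using n_pos by simp
qed

lemma annihilates_normal_poly_iff:
  "(monom 1 n - 1) dvd map_poly \<iota> f * normal_poly q n \<alpha> \<longleftrightarrow> act f \<alpha> = 0"
  using normal_poly_act[of f \<alpha>] normal_poly_dvd_0[of "act f \<alpha>"]
  by (metis dvd_diff_right_iff diff_zero normal_poly_0)

text \<open>Frobenius on coefficients fixes x^n - 1 and sends g_\<alpha> to the polynomial of
  \<open>\<alpha> ^ q\<close>, which is x g_\<alpha> modulo x^n - 1. The extra factor x is a unit
  there.\<close>

lemma frobenius_annihilates_normal_poly:
  assumes "(monom 1 n - 1) dvd F * normal_poly q n \<alpha>"
  shows "(monom 1 n - 1) dvd map_poly (\<lambda>x. x ^ q) F * normal_poly q n (\<alpha> :: 'a)"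
proof -
  let ?\<sigma> = "map_poly (\<lambda>x :: 'a. x ^ q)" and ?X = "monom 1 n - 1 :: 'a poly"
  have \<sigma>_mult: "?\<sigma> (F * G) = ?\<sigma> F * ?\<sigma> G" for F G
    using q_gt_1 by (intro map_poly_mult_hom) (auto simp: power_q_add power_mult_distrib)
  have \<sigma>_add: "?\<sigma> (F + G) = ?\<sigma> F + ?\<sigma> G" for F G
    using q_gt_1 by (intro map_poly_add_hom) (auto simp: power_q_add)
  have "?\<sigma> ?X + ?\<sigma> 1 = ?\<sigma> (monom 1 n)"
    by (metis \<sigma>_add diff_add_cancel)
  then have "?\<sigma> ?X = ?X"
    using q_gt_1 by (simp add: map_poly_monom power_0_left algebra_simps)
  then have "?X dvd ?\<sigma> F * normal_poly q n (\<alpha> ^ q)"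
    using assms by (metis dvd_def \<sigma>_mult map_poly_frobenius_normal_poly)
  then have "?X dvd ?\<sigma> F * (monom 1 1 * normal_poly q n \<alpha>)"
    unfolding normal_poly_shift distrib_left by (rule dvd_add) (auto intro: dvd_smult)
  \<comment> \<open>The inverse of x modulo x^n - 1 is x^(n-1).\<close>
  then have X_dvd: "?X dvd monom 1 (n - 1) * (?\<sigma> F * (monom 1 1 * normal_poly q n \<alpha>))"
    by (rule dvd_mult)
  have x_power_n: "monom 1 n = monom 1 (n - 1) * monom (1 :: 'a) 1"
    using n_pos by (simp add: mult_monom)
  note X_dvd
  also have "monom 1 (n - 1) * (?\<sigma> F * (monom 1 1 * normal_poly q n \<alpha>)) = monom 1 n * (?\<sigma> F * normal_poly q n \<alpha>)"
    by (simp only: x_power_n mult_ac)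
  also have "\<dots> = ?\<sigma> F * normal_poly q n \<alpha> + ?X * (?\<sigma> F * normal_poly q n \<alpha>)"
    by (simp add: algebra_simps)
  finally show ?thesis
    by (simp only: dvd_add_left_iff[OF dvd_triv_left])
qed

text \<open>
  The ideal of all \<open>F\<close> over the extension field with \<open>x\<^sup>n - 1\<close> dividing \<open>F g\<^sub>\<alpha>\<close> is stable under
  the Frobenius map on coefficients. Hence so is its monic generator, which therefore descends
  to the ground field, where divisibility by \<open>M\<close> decides membership.
\<close>
lemma annihilator_normal_poly_dvd:
  assumes M: "\<And>f. act f \<alpha> = 0 \<longleftrightarrow> M dvd f"
    and F: "(monom 1 n - 1) dvd F * normal_poly q n (\<alpha> :: 'a)"
  shows "map_poly \<iota> M dvd F"
proof -
  let ?\<sigma> = "map_poly (\<lambda>x :: 'a. x ^ q)"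
  define I where "I = {F. (monom 1 n - 1) dvd F * normal_poly q n \<alpha>}"
  have diff: "f - g \<in> I" if "f \<in> I" "g \<in> I" for f g
    using that by (simp add: I_def left_diff_distrib)
  have mult: "g * f \<in> I" if "f \<in> I" for f g
    using that by (simp add: I_def mult.assoc)
  have X: "monom 1 n - 1 \<in> I" by (simp add: I_def)
  obtain D where D: "D \<in> I" "lead_coeff D = 1" "\<And>f. f \<in> I \<Longrightarrow> D dvd f"
    using poly_ideal_generator[OF X x_power_n_nonzero diff mult] by blast
  have "?\<sigma> D \<in> I"
    using D(1) frobenius_annihilates_normal_poly by (simp add: I_def)
  then obtain h where h: "?\<sigma> D = D * h" using D(3) by blast
  \<comment> \<open>Equal degrees make the cofactor \<open>h\<close> constant, and both sides being
    monic makes it 1. Thus Frobenius fixes every coefficient of \<open>D\<close>.\<close>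
  have deg: "degree (?\<sigma> D) = degree D"
    by (rule degree_map_poly) simp
  have "lead_coeff (?\<sigma> D) = 1"
    using q_gt_1 D(2) by (simp add: deg coeff_map_poly)
  then have "?\<sigma> D \<noteq> 0" by auto
  then have "degree h = 0"
    using h deg by (metis add_cancel_right_right degree_mult_eq mult_zero_left mult_zero_right)
  then obtain c where "h = [:c:]" by (rule degree_eq_zeroE)
  with h have "?\<sigma> D = smult c D" by simp
  with \<open>lead_coeff (?\<sigma> D) = 1\<close> D(2) have "?\<sigma> D = D"
    by (metis lead_coeff_smult mult.right_neutral smult_1_left)
  then have "coeff D i ^ q = coeff D i" for i
    using q_gt_1 coeff_map_poly[of "\<lambda>x. x ^ q" D i] by simp
  then have "coeff D i \<in> range \<iota>" for i
    by (rule power_q_eq_self)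
  then have "\<iota> (inv_into UNIV \<iota> (coeff D i)) = coeff D i" for i
    by (simp add: f_inv_into_f)
  \<comment> \<open>Mapping coefficients is well behaved only for a function that sends 0 to
    0.\<close>
  moreover have "inv_into UNIV \<iota> 0 = 0"
    using inv_f_f[OF inj_hom, of 0] by simp
  ultimately have D_eq: "D = map_poly \<iota> (map_poly (inv_into UNIV \<iota>) D)"
    by (intro poly_eqI) (simp add: coeff_map_poly)
  then have "act (map_poly (inv_into UNIV \<iota>) D) \<alpha> = 0"
    using D(1) by (simp add: I_def flip: annihilates_normal_poly_iff D_eq)
  then have "M dvd map_poly (inv_into UNIV \<iota>) D"
    using M by simp
  then have "map_poly \<iota> M dvd D"
    using D_eq by (metis dvd_def map_poly_hom_mult)
  also have "D dvd F"
    using F by (intro D(3)) (simp add: I_def)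
  finally show ?thesis .
qed

section \<open>Normality and the minimal q-polynomial, read off from the annihilator\<close>

lemma degree_map_poly_hom: "degree (map_poly \<iota> f) = degree f"
  by (rule degree_map_poly) simp

text \<open>With x^n - 1 = M d, the gcd is d over the extension. The degree bound makes the natural
  subtraction exact.\<close>

lemma k_normal_of_annihilator:
  assumes "\<alpha> \<noteq> 0" and M: "\<And>f. act f \<alpha> = 0 \<longleftrightarrow> M dvd f"
  shows "degree M \<le> n" "k_normal q n (n - degree M) \<alpha>"
proof -
  let ?X = "monom 1 n - 1 :: 'a poly" and ?g = "normal_poly q n \<alpha>" and ?M = "map_poly \<iota> M"
  have "M dvd monom 1 n - 1"
    using act_x_power_n M by blast
  then obtain d where "monom 1 n - 1 = M * d" by blast
  then have "map_poly \<iota> (monom 1 n - 1) = ?M * map_poly \<iota> d"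
    by (simp add: map_poly_hom_mult)
  then have X: "?X = ?M * map_poly \<iota> d"
    by (simp add: map_poly_hom_diff map_poly_monom)
  have nz: "?M \<noteq> 0" "map_poly \<iota> d \<noteq> 0"
    using X x_power_n_nonzero[where ?'b = 'a] by auto
  then have n: "n = degree M + degree (map_poly \<iota> d)"
    using X degree_x_power_n[where ?'b = 'a] by (metis degree_map_poly_hom degree_mult_eq)
  \<comment> \<open>This gives the strict bound k < n demanded by \<open>k_normal\<close>.\<close>
  have "degree M \<noteq> 0"
  proof
    assume "degree M = 0"
    moreover have "M \<noteq> 0" using nz(1) by auto
    ultimately have "M dvd 1" by (simp add: is_unit_iff_degree)
    then show False using M[of 1] \<open>\<alpha> \<noteq> 0\<close> by simp
  qed
  have "is_gcd (map_poly \<iota> d) ?g ?X"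
    unfolding is_gcd_def
  proof (intro conjI allI impI)
    have "?X dvd ?M * ?g"
      using M[of M] by (simp add: annihilates_normal_poly_iff)
    then show "map_poly \<iota> d dvd ?g"
      using nz(1) by (simp add: X)
    show "map_poly \<iota> d dvd ?X"
      by (simp add: X)
    fix c
    assume c: "c dvd ?g \<and> c dvd ?X"
    then obtain u where u: "?X = c * u" by blast
    \<comment> \<open>The cofactor \<open>u\<close> of a common divisor \<open>c\<close> annihilates
      g_\<alpha> modulo x^n - 1, hence is a multiple of M; cancelling M leaves \<open>c\<close>
      dividing d.\<close>
    have "?X dvd u * ?g"
      using c by (simp add: u mult.commute mult_dvd_mono)
    then have "?M dvd u"
      by (rule annihilator_normal_poly_dvd[OF M])
    then obtain v where "u = ?M * v" by blast
    with u X have "?M * map_poly \<iota> d = ?M * (c * v)"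
      by (simp add: mult_ac)
    with nz(1) show "c dvd map_poly \<iota> d" by simp
  qed
  then show "degree M \<le> n" "k_normal q n (n - degree M) \<alpha>"
    using n \<open>\<alpha> \<noteq> 0\<close> \<open>degree M \<noteq> 0\<close> unfolding k_normal_def by auto
qed

lemma min_qpoly_of_annihilator:
  assumes M: "\<And>f. act f \<alpha> = 0 \<longleftrightarrow> M dvd f" and monic: "lead_coeff M = 1"
  shows "min_qpoly \<iota> q \<alpha> = qassoc q M"
proof -
  have ann: "qannihilator \<iota> q \<alpha> = qassoc q ` {f. M dvd f}"
    by (auto simp: qannihilator_def carrier_qpoly_ring simp flip: act_def M)
  show ?thesis
    unfolding min_qpoly_def
  proof (rule the_equality)
    show "qassoc q M \<in> carrier (qpoly_ring q) \<and> lead_coeff (qassoc q M) = 1 \<and>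
      qannihilator \<iota> q \<alpha> = PIdl\<^bsub>qpoly_ring q\<^esub> (qassoc q M)"
      using monic lead_coeff_qassoc[OF q_gt_1, of M]
      by (auto simp: ann cgenideal_qassoc carrier_qpoly_ring)
  next
    fix N
    assume N: "N \<in> carrier (qpoly_ring q) \<and> lead_coeff N = 1 \<and>
      qannihilator \<iota> q \<alpha> = PIdl\<^bsub>qpoly_ring q\<^esub> N"
    then obtain f where f: "N = qassoc q f" by (auto simp: carrier_qpoly_ring)
    \<comment> \<open>Injectivity of \<open>qassoc\<close> reduces equality of the ideals to
      equality of sets of multiples, which determines a monic generator.\<close>
    with N have "{g. M dvd g} = {g. f dvd g}"
      by (simp add: ann cgenideal_qassoc inj_image_eq_iff[OF inj_qassoc[OF q_gt_1]])
    then have "M dvd f" "f dvd M" using dvd_refl by blast+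
    moreover have "lead_coeff f = 1"
      using N unfolding f lead_coeff_qassoc[OF q_gt_1] by blast
    ultimately show "N = qassoc q M"
      unfolding f using monic monic_dvd_antisym[of f M] by blast
  qed
qed

end

theorem theorem2p3:
  fixes \<iota> :: "'k::{finite, field} \<Rightarrow> 'a::{finite, field}"
    and p m q n s :: nat
    and f e :: "nat \<Rightarrow> 'k poly"
    and \<alpha> :: 'a
    and \<Delta> :: "nat set"
  assumes "prime p" and "m \<ge> 1" and "q = p ^ m"
    and "n \<ge> 1" and "coprime n p"
    and "CARD('k) = q" and "CARD('a) = q ^ n"
    and "\<iota> 1 = 1"
    and "\<And>x y. \<iota> (x + y) = \<iota> x + \<iota> y"
    and "\<And>x y. \<iota> (x * y) = \<iota> x * \<iota> y"
    and "(\<Prod>i = 1..s. f i) = monom 1 n - 1"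
    and "\<And>i. i \<in> {1..s} \<Longrightarrow> irreducible (f i)"
    and "\<And>i. i \<in> {1..s} \<Longrightarrow> lead_coeff (f i) = 1"
    and "inj_on f {1..s}"
    and "\<And>i j. i \<in> {1..s} \<Longrightarrow> j \<in> {1..s} \<Longrightarrow> [e i = (if i = j then 1 else 0)] (mod f j)"
    and "\<alpha> \<noteq> 0"
    and "\<Delta> = {i \<in> {1..s}. eval_ext \<iota> (qassoc q (e i)) \<alpha> \<noteq> 0}"
  shows "min_qpoly \<iota> q \<alpha> = (\<Otimes>\<^bsub>qpoly_ring q\<^esub>i\<in>\<Delta>. qassoc q (f i)) \<and>
         (\<exists>k. int k = int n - (\<Sum>i\<in>\<Delta>. int (degree (f i))) \<and> k_normal q n k \<alpha>)"
proof -
  interpret finite_field_extension \<iota> p m q n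
    by standard (fact assms)+
  note prod_f = assms(11) and irr = assms(12) and monic = assms(13) and inj = assms(14)
  have \<Delta>: "\<Delta> = {i \<in> {1..s}. act (e i) \<alpha> \<noteq> 0}" "\<Delta> \<subseteq> {1..s}" "finite \<Delta>"
    by (auto simp: assms(17) act_def)
  have e_self: "f i dvd e i - 1" if "i \<in> {1..s}" for i
    using assms(15)[OF that that] by (simp add: cong_iff_dvd_diff)
  have e_other: "f j dvd e i" if "i \<in> {1..s}" "j \<in> {1..s}" "i \<noteq> j" for i j
    using assms(15)[OF that(1,2)] that(3) by (simp add: cong_iff_dvd_diff)
  \<comment> \<open>Divisibility by every \<open>f j\<close> means divisibility by x^n - 1, which
    acts as zero.\<close>
  have act_0I: "act g \<beta> = 0" if "\<And>j. j \<in> {1..s} \<Longrightarrow> f j dvd g" for g \<beta>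
  proof -
    have "(\<Prod>i=1..s. f i) dvd g"
      by (rule prod_monic_irreducible_dvd[OF _ inj irr monic that]) auto
    then show ?thesis
      unfolding prod_f by (rule act_eq_0_dvd[OF act_x_power_n])
  qed
  have kill: "act (f i) (act (e i) \<alpha>) = 0" if "i \<in> {1..s}" for i
  proof -
    have "f j dvd f i * e i" if "j \<in> {1..s}" for j
      using that e_other[OF \<open>i \<in> {1..s}\<close> that] by (cases "i = j") auto
    then show ?thesis using act_0I by (simp flip: act_mult)
  qed
  define M where "M = (\<Prod>i\<in>\<Delta>. f i)"
  \<comment> \<open>The idempotents sum to 1 modulo every \<open>f j\<close>: there only
    \<open>e j\<close> survives, and it is congruent to 1.\<close>
  have decomp: "\<beta> = (\<Sum>i=1..s. act (e i) \<beta>)" for \<beta>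
  proof -
    have "act (1 - (\<Sum>i=1..s. e i)) \<beta> = 0"
    proof (rule act_0I)
      fix j assume j: "j \<in> {1..s}"
      have "1 - (\<Sum>i=1..s. e i) = - (e j - 1) - (\<Sum>i\<in>{1..s}-{j}. e i)"
        using j by (subst sum.remove[of _ j]) auto
      also have "f j dvd \<dots>"
        by (intro dvd_diff dvd_sum) (use j e_self[OF j] e_other in \<open>auto simp only: dvd_minus_iff\<close>)
      finally show "f j dvd 1 - (\<Sum>i=1..s. e i)" .
    qed
    then show ?thesis by (simp add: act_diff act_sum)
  qed
  have M: "act g \<alpha> = 0 \<longleftrightarrow> M dvd g" for g
  proof
    assume g: "act g \<alpha> = 0"
    have "f i dvd g" if "i \<in> \<Delta>" for i
    proof (rule irreducible_dvd_annihilator)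
      have i: "i \<in> {1..s}" using that \<Delta>(2) by blast
      show "irreducible (f i)" "act (f i) (act (e i) \<alpha>) = 0"
        using i irr kill by auto
      \<comment> \<open>Polynomials commute, so whatever kills \<alpha> kills each of its
        components.\<close>
      show "act g (act (e i) \<alpha>) = 0"
        using g by (metis act_mult act_zero_right mult.commute)
      show "act (e i) \<alpha> \<noteq> 0" using that \<Delta>(1) by blast
    qed
    then show "M dvd g"
      unfolding M_def using \<Delta> irr monic inj_on_subset[OF inj \<Delta>(2)]
      by (intro prod_monic_irreducible_dvd) auto
  next
    assume "M dvd g"
    \<comment> \<open>A component in \<Delta> is killed by its own factor of M; any other component
      is already 0.\<close>
    have "act g (act (e i) \<alpha>) = 0" if "i \<in> {1..s}" for i
    proof (cases "i \<in> \<Delta>")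
      case True
      then have "f i dvd g"
        using \<open>M dvd g\<close> \<Delta>(3) unfolding M_def by (meson dvd_prodI dvd_trans)
      then show ?thesis using act_eq_0_dvd kill that by blast
    next
      case False
      then show ?thesis using that \<Delta>(1) by auto
    qed
    then have "(\<Sum>i=1..s. act (e i) (act g \<alpha>)) = 0"
      by (intro sum.neutral ballI) (metis act_mult mult.commute)
    then show "act g \<alpha> = 0" using decomp[of "act g \<alpha>"] by simp
  qed
  have "lead_coeff M = 1"
    unfolding M_def using monic \<Delta>(2) by (subst lead_coeff_prod) (auto intro!: prod.neutral)
  then have "min_qpoly \<iota> q \<alpha> = (\<Otimes>\<^bsub>qpoly_ring q\<^esub>i\<in>\<Delta>. qassoc q (f i))"
    using min_qpoly_of_annihilator[OF M] by (simp add: finprod_qassoc[OF \<Delta>(3)] M_def)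
  moreover have "degree M = (\<Sum>i\<in>\<Delta>. degree (f i))"
  proof -
    have "f i \<noteq> 0" if "i \<in> \<Delta>" for i
      using irr[of i] \<Delta>(2) that by auto
    then show ?thesis
      unfolding M_def by (intro degree_prod_eq_sum_degree) auto
  qed
  ultimately show ?thesis
    using k_normal_of_annihilator[OF \<open>\<alpha> \<noteq> 0\<close> M]
    by (intro conjI exI[of _ "n - degree M"]) (auto simp: of_nat_diff)
qed

end
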